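(* Assume the Axiom of Choice. There exists a function $f:\mathbb{R}\to\mathbb{R}$ which is $\tau_{\mathbb{Q}}$-continuous but is $\mathbb{Q}$-continuous at no point of $\mathbb{R}$.
   Context: The Axiom of Choice is assumed in addition to ZF. The topology $\tau_{\mathbb{Q}}$ on $\mathbb{R}$: a set $U\subseteq\mathbb{R}$ is $\tau_{\mathbb{Q}}$-open iff for every $a\in U$ and every real $x\neq0$ there is $\varepsilon(a,x)>0$ such that $a+qx\in U$ for all $q\in\mathbb{Q}$ with $0<q<\varepsilon(a,x)$. A function is $\tau_{\mathbb{Q}}$-continuous if it is continuous from $(\mathbb{R},\tau_{\mathbb{Q}})$ to $\mathbb{R}$ with the usual topology. For real $y\neq z$ put $S(y,z)=\{qy+(1-q)z: q\in\mathbb{Q}\cap[0,1]\}$. $f:\mathbb{R}\to\mathbb{R}$ is $\mathbb{Q}$-continuous at $x$ from the left if there is $\epsilon>0$ such that for all $y,z$ with $x-\epsilon<y<z\le x$ there is a continuous (in the usual sense) function $f_{y,z}:[y,z]\to\mathbb{R}$ with $f_{y,z}(t)=f(t)$ for all $t\in S(y,z)$; from the right: analogously with $x\le y<z<x+\epsilon$. $f$ is $\mathbb{Q}$-continuous at $x$ if it is $\mathbb{Q}$-continuous at $x$ from both sides. *)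

theory Defs
  imports "HOL-Analysis.Abstract_Topology"
begin

definition tauQ_open :: "real set \<Rightarrow> bool" where
  "tauQ_open U \<longleftrightarrow>
    (\<forall>a\<in>U. \<forall>x. x \<noteq> 0 \<longrightarrow> (\<exists>\<epsilon>>0. \<forall>q\<in>\<rat>. 0 < q \<and> q < \<epsilon> \<longrightarrow> a + q * x \<in> U))"

definition tauQ :: "real topology" where
  "tauQ = topology tauQ_open"

lemma istopology_tauQ_open: "istopology tauQ_open"
  unfolding istopology_def
proof (intro conjI allI impI)
  fix S T :: "real set"
  assume S: "tauQ_open S" and T: "tauQ_open T"
  show "tauQ_open (S \<inter> T)"
    unfolding tauQ_open_def
  proof (intro ballI allI impI)
    fix a x :: real
    assume a: "a \<in> S \<inter> T" and x: "x \<noteq> 0"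
    obtain d where "d > 0" "\<forall>q\<in>\<rat>. 0 < q \<and> q < d \<longrightarrow> a + q * x \<in> S"
      using S a x unfolding tauQ_open_def by blast
    moreover obtain e where "e > 0" "\<forall>q\<in>\<rat>. 0 < q \<and> q < e \<longrightarrow> a + q * x \<in> T"
      using T a x unfolding tauQ_open_def by blast
    ultimately show "\<exists>\<epsilon>>0. \<forall>q\<in>\<rat>. 0 < q \<and> q < \<epsilon> \<longrightarrow> a + q * x \<in> S \<inter> T"
      by (intro exI[of _ "min d e"]) simp
  qed
next
  fix \<K> :: "real set set"
  assume K: "\<forall>K\<in>\<K>. tauQ_open K"
  show "tauQ_open (\<Union>\<K>)"
    unfolding tauQ_open_def
  proof (intro ballI allI impI)
    fix a x :: real
    assume "a \<in> \<Union>\<K>" and x: "x \<noteq> 0"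
    then obtain K where "K \<in> \<K>" "a \<in> K" by blast
    then obtain d where "d > 0" "\<forall>q\<in>\<rat>. 0 < q \<and> q < d \<longrightarrow> a + q * x \<in> K"
      using K x unfolding tauQ_open_def by blast
    with \<open>K \<in> \<K>\<close> show "\<exists>\<epsilon>>0. \<forall>q\<in>\<rat>. 0 < q \<and> q < \<epsilon> \<longrightarrow> a + q * x \<in> \<Union>\<K>"
      by blast
  qed
qed

lemma openin_tauQ: "openin tauQ U \<longleftrightarrow> tauQ_open U"
  by (simp add: tauQ_def istopology_tauQ_open topology_inverse')

lemma topspace_tauQ: "topspace tauQ = UNIV"
proof -
  have "openin tauQ UNIV"
    unfolding openin_tauQ tauQ_open_def by (auto intro: exI[of _ 1])
  then show ?thesis
    using openin_subset by blast
qed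

definition tauQ_continuous :: "(real \<Rightarrow> real) \<Rightarrow> bool" where
  "tauQ_continuous f \<longleftrightarrow> continuous_map tauQ euclideanreal f"

definition rat_segment :: "real \<Rightarrow> real \<Rightarrow> real set" where
  "rat_segment y z = {q * y + (1 - q) * z | q. q \<in> \<rat> \<and> 0 \<le> q \<and> q \<le> 1}"

text \<open>A continuous function on the closed interval between \<open>y\<close> and \<open>z\<close> is rendered as a total
  function that is continuous on that interval; its values elsewhere are irrelevant.\<close>

definition continuously_extendable :: "(real \<Rightarrow> real) \<Rightarrow> real \<Rightarrow> real \<Rightarrow> bool" where
  "continuously_extendable f y z \<longleftrightarrow>
    (\<exists>g::real \<Rightarrow> real. continuous_on {y..z} g \<and> (\<forall>t\<in>rat_segment y z. g t = f t))"

definition Q_continuous_left :: "(real \<Rightarrow> real) \<Rightarrow> real \<Rightarrow> bool" where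
  "Q_continuous_left f x \<longleftrightarrow>
    (\<exists>\<epsilon>>0. \<forall>y z. x - \<epsilon> < y \<and> y < z \<and> z \<le> x \<longrightarrow> continuously_extendable f y z)"

definition Q_continuous_right :: "(real \<Rightarrow> real) \<Rightarrow> real \<Rightarrow> bool" where
  "Q_continuous_right f x \<longleftrightarrow>
    (\<exists>\<epsilon>>0. \<forall>y z. x \<le> y \<and> y < z \<and> z < x + \<epsilon> \<longrightarrow> continuously_extendable f y z)"

definition Q_continuous_at :: "(real \<Rightarrow> real) \<Rightarrow> real \<Rightarrow> bool" where
  "Q_continuous_at f x \<longleftrightarrow> Q_continuous_left f x \<and> Q_continuous_right f x"

end

theory Submission
  imports
    Defs
    "HOL-Analysis.Continuum_Not_Denumerable"
    "HOL-Analysis.Elementary_Metric_Spaces"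
    "HOL-Library.Indicator_Function"
begin

text \<open>
  A set is open for \<open>\<tau>\<^sub>\<rat>\<close> as soon as every rational ray starting in it stays in it for
  a while.
  Hence \<open>\<tau>\<^sub>\<rat>\<close>-continuity only concerns the restrictions of \<open>f\<close> to the affine lines
  \<open>a + \<rat> x\<close> of the \<open>\<rat>\<close>-vector space \<open>\<real>\<close>, and on such a line a function may jump at a gap
  of \<open>\<rat>\<close> without losing continuity. An extension to a real interval, however, fills the gap and
  cannot exist.

  To place such a jump to the left of every point and arbitrarily close to it, the axiom of choice
  (in the form of a basis of \<open>\<real>\<close> over \<open>\<rat>\<close>) provides a \<open>\<rat>\<close>-linear functional \<open>h : \<real> \<Rightarrow> \<rat>\<close> with \<open>h 1 = 1\<close> and
  \<open>h \<theta> = 0\<close>, where \<open>0 < \<theta> < 1\<close> is irrational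
  (\<open>ex_rational_functional_separating\<close>). Let \<open>f\<close> be the indicator function of
  \<open>{x. h x < \<theta>}\<close>. The value \<open>h x\<close> is rational, hence never equal to \<open>\<theta>\<close>, and it varies
  affinely along a rational ray; so \<open>f\<close> is constant at the beginning of each ray
  (\<open>tauQ_continuous_cut\<close>). On the other hand all fibres of \<open>h\<close> are dense
  (\<open>rational_functional_fibre_dense\<close>), so every interval contains points \<open>y < z\<close> with
  \<open>h y = 0\<close> and \<open>h z = 1\<close>, that is, with different values of \<open>f\<close>. A continuous function that
  agrees with \<open>f\<close> on the dense subset \<open>S(y,z)\<close> of \<open>[y,z]\<close> would take only the values \<open>0\<close> and
  \<open>1\<close>, and both of them, against connectedness
  (\<open>not_extendable_if_two_valued\<close>).
\<close>

lemma ex_irrational_between: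
  fixes a b :: real
  assumes "a < b"
  obtains c where "a < c" "c < b" "c \<notin> \<rat>"
proof -
  have "countable (\<rat> :: real set)"
    unfolding Rats_def by simp
  with assms have "\<not> {a<..<b} \<subseteq> \<rat>"
    using countable_subset uncountable_open_interval by blast
  then obtain c where "c \<in> {a<..<b}" "c \<notin> \<rat>" by blast
  with that[of c] show ?thesis by simp
qed

definition rational_functional :: "(real \<Rightarrow> rat) \<Rightarrow> bool" where
  "rational_functional h \<longleftrightarrow>
    (\<forall>x y. h (x + y) = h x + h y) \<and> (\<forall>q x. h (of_rat q * x) = q * h x)"

text \<open>An irrational number is linearly independent of \<open>1\<close> over \<open>\<rat>\<close>, so the values of a
  functional on the two can be prescribed on a basis extending \<open>{1, \<theta>}\<close>.\<close>

lemma ex_rational_functional_separating: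
  fixes \<theta> :: real
  assumes "\<theta> \<notin> \<rat>"
  obtains h where "rational_functional h" "h 1 = 1" "h \<theta> = 0"
proof -
  let ?sR = "\<lambda>(q::rat) (x::real). of_rat q * x" and ?sQ = "\<lambda>(q::rat) (x::rat). q * x"
  interpret vector_space_pair ?sR ?sQ
    by unfold_locales (auto simp: algebra_simps of_rat_add of_rat_mult)
  have "\<theta> \<notin> vs1.span {1}"
    using assms by (auto simp: vs1.span_singleton)
  then have "vs1.independent {\<theta>, 1}"
    by (intro vs1.independent_insertI) (simp_all add: vs1.independent_empty)
  then obtain h where h: "Vector_Spaces.linear ?sR ?sQ h" "\<forall>x\<in>{\<theta>, 1}. h x = (if x = 1 then 1 else 0)"
    using linear_independent_extend[of "{\<theta>, 1}" "\<lambda>x. if x = 1 then 1 else 0"] by blast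
  interpret h: Vector_Spaces.linear ?sR ?sQ h by fact
  have "rational_functional h"
    unfolding rational_functional_def using h.add h.scale by blast
  moreover have "\<theta> \<noteq> 1" using assms by auto
  ultimately show ?thesis using that h(2) by auto
qed

text \<open>Adding rational multiples of a nonzero vector of the kernel does not change the value of
  \<open>h\<close>, and these multiples are dense in \<open>\<real>\<close>.\<close>

lemma rational_functional_fibre_dense:
  assumes h: "rational_functional h" and \<theta>: "h \<theta> = 0" "0 < \<theta>" and "a < b"
  obtains c where "a < c" "c < b" "h c = h x"
proof -
  have "(a - x) / \<theta> < (b - x) / \<theta>"
    using \<open>a < b\<close> \<theta>(2) by (simp add: divide_strict_right_mono)
  then obtain q where q: "(a - x) / \<theta> < of_rat q" "of_rat q < (b - x) / \<theta>"
    using of_rat_dense by blast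
  show ?thesis
  proof (rule that)
    show "a < x + of_rat q * \<theta>" "x + of_rat q * \<theta> < b"
      using q \<theta>(2) by (auto simp: field_simps)
    show "h (x + of_rat q * \<theta>) = h x"
      using h \<theta>(1) by (simp add: rational_functional_def)
  qed
qed

lemma tauQ_continuous_if_eventually_constant_on_rays:
  assumes "\<And>a x. x \<noteq> 0 \<Longrightarrow> \<exists>\<epsilon>>0. \<forall>q\<in>\<rat>. 0 < q \<and> q < \<epsilon> \<longrightarrow> f (a + q * x) = f a"
  shows "tauQ_continuous f"
proof -
  have "tauQ_open {x. f x \<in> U}" for U
    unfolding tauQ_open_def
  proof (intro ballI allI impI)
    fix a x :: real
    assume a: "a \<in> {x. f x \<in> U}" and "x \<noteq> 0"
    then obtain \<epsilon> where "\<epsilon> > 0" "\<forall>q\<in>\<rat>. 0 < q \<and> q < \<epsilon> \<longrightarrow> f (a + q * x) = f a"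
      using assms by blast
    with a show "\<exists>\<epsilon>>0. \<forall>q\<in>\<rat>. 0 < q \<and> q < \<epsilon> \<longrightarrow> a + q * x \<in> {x. f x \<in> U}"
      by (intro exI[of _ \<epsilon>]) simp
  qed
  then show ?thesis
    by (simp add: tauQ_continuous_def continuous_map_def topspace_tauQ openin_tauQ)
qed

text \<open>The rational number \<open>h a\<close> has a positive distance from the gap \<open>\<theta>\<close>, and
  \<open>h (a + q * x) = h a + q * h x\<close> stays within that distance for small \<open>q\<close>.\<close>

lemma tauQ_continuous_cut:
  fixes \<theta> :: real
  assumes h: "rational_functional h" and \<theta>: "\<theta> \<notin> \<rat>"
  shows "tauQ_continuous (indicator {x. of_rat (h x) < \<theta>})"
proof (rule tauQ_continuous_if_eventually_constant_on_rays)
  fix a x :: real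
  let ?d = "\<bar>of_rat (h a) - \<theta>\<bar>" and ?k = "\<bar>of_rat (h x)\<bar> :: real"
  have d: "?d > 0" using \<theta> by auto
  \<comment> \<open>The summand \<open>1\<close> avoids a division by zero when \<open>h x = 0\<close>.\<close>
  let ?\<epsilon> = "?d / (?k + 1)"
  have "(of_rat (h (a + q * x)) < \<theta>) = (of_rat (h a) < \<theta>)"
    if q: "q \<in> \<rat>" "0 < q" "q < ?\<epsilon>" for q
  proof -
    obtain r where r: "q = of_rat r" using q(1) by (auto elim: Rats_cases)
    have eq: "of_rat (h (a + q * x)) = of_rat (h a) + q * of_rat (h x)"
      using h by (simp add: r rational_functional_def of_rat_add of_rat_mult)
    have "\<bar>q * of_rat (h x)\<bar> = q * ?k"
      using q(2) by (simp add: abs_mult)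
    also have "\<dots> < q * (?k + 1)" using q(2) by simp
    also have "\<dots> < ?d"
      using q(3) pos_less_divide_eq[of "?k + 1" q ?d] by linarith
    finally show ?thesis unfolding eq by linarith
  qed
  moreover have "?\<epsilon> > 0" using d by (intro divide_pos_pos add_nonneg_pos) simp_all
  ultimately show "\<exists>\<epsilon>>0. \<forall>q\<in>\<rat>. 0 < q \<and> q < \<epsilon> \<longrightarrow>
      indicator {x. of_rat (h x) < \<theta>} (a + q * x) =
      (indicator {x. of_rat (h x) < \<theta>} a :: real)"
    by (intro exI[of _ ?\<epsilon>]) (simp add: indicator_def)
qed

text \<open>By the intermediate value theorem an extension would take the value \<open>1/2\<close> somewhere on the
  segment, hence values different from \<open>0\<close> and \<open>1\<close> in a whole neighbourhood, which contains points
  with a rational parameter.\<close>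

lemma not_extendable_if_two_valued:
  assumes "y < z" and y: "y \<in> A" and z: "z \<notin> A"
  shows "\<not> continuously_extendable (indicator A) y z"
proof
  assume "continuously_extendable (indicator A) y z"
  then obtain g :: "real \<Rightarrow> real" where g: "continuous_on {y..z} g"
    and ext: "\<forall>t\<in>rat_segment y z. g t = indicator A t"
    unfolding continuously_extendable_def by blast
  define G where "G t = g (t * y + (1 - t) * z)" for t
  have seg: "t * y + (1 - t) * z \<in> {y..z}" if "t \<in> {0..1}" for t
  proof -
    have "t * (z - y) \<ge> 0" "(1 - t) * (z - y) \<ge> 0" using that \<open>y < z\<close> by simp_all
    then show ?thesis by (simp add: algebra_simps)
  qed
  have cont: "continuous_on {0..1} G"
    unfolding G_def using seg
    by (intro continuous_on_compose2[OF g] continuous_intros) auto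
  have G: "G q = indicator A (q * y + (1 - q) * z)" if "q \<in> \<rat>" "0 \<le> q" "q \<le> 1" for q
    unfolding G_def using ext that by (auto simp: rat_segment_def)
  have "G 0 = 0" "G 1 = 1"
    using G[of 0] G[of 1] y z by auto
  then obtain t where t: "0 \<le> t" "t \<le> 1" "G t = 1/2"
    using IVT'[of G 0 "1/2" 1] cont by auto
  have "\<exists>d>0. \<forall>s\<in>{0..1}. dist s t < d \<longrightarrow> dist (G s) (G t) < 1/2"
    using cont[unfolded continuous_on_iff, rule_format, of t "1/2"] t(1,2) by simp
  then obtain d where d: "d > 0" "\<forall>s\<in>{0..1}. dist s t < d \<longrightarrow> dist (G s) (G t) < 1/2"
    by blast
  have "max 0 (t - d) < min 1 (t + d)" using t d(1) by auto
  then obtain q where q: "q \<in> \<rat>" "max 0 (t - d) < q" "q < min 1 (t + d)"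
    using Rats_dense_in_real by blast
  then have "dist (G q) (G t) < 1/2"
    using d(2)[rule_format, of q] by (auto simp: dist_real_def)
  moreover have "G q = 0 \<or> G q = 1"
    using G[of q] q by (auto simp: indicator_def)
  ultimately show False
    using t(3) by (auto simp: dist_real_def)
qed

theorem theorem9p6:
  "\<exists>f::real \<Rightarrow> real. tauQ_continuous f \<and> (\<forall>x. \<not> Q_continuous_at f x)"
proof -
  obtain \<theta> :: real where \<theta>: "0 < \<theta>" "\<theta> < 1" "\<theta> \<notin> \<rat>"
    using ex_irrational_between[of 0 1] by auto
  obtain h where h: "rational_functional h" "h 1 = 1" "h \<theta> = 0"
    using ex_rational_functional_separating[OF \<theta>(3)] .
  let ?A = "{x. of_rat (h x) < \<theta>}"
  have "\<not> Q_continuous_left (indicator ?A) x" for x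
  proof
    assume "Q_continuous_left (indicator ?A) x"
    then obtain \<epsilon> where "\<epsilon> > 0" and
      ext: "\<And>y z. x - \<epsilon> < y \<Longrightarrow> y < z \<Longrightarrow> z \<le> x \<Longrightarrow>
        continuously_extendable (indicator ?A) y z"
      unfolding Q_continuous_left_def by blast
    obtain y where y: "x - \<epsilon> < y" "y < x" "h y = h \<theta>"
      using rational_functional_fibre_dense[OF h(1,3) \<theta>(1), of "x - \<epsilon>" x \<theta>] \<open>\<epsilon> > 0\<close> by auto
    obtain z where z: "y < z" "z < x" "h z = h 1"
      using rational_functional_fibre_dense[OF h(1,3) \<theta>(1) y(2), of 1] by auto
    have "y \<in> ?A" "z \<notin> ?A" using y z h \<theta> by auto
    then have "\<not> continuously_extendable (indicator ?A) y z"
      by (rule not_extendable_if_two_valued[OF z(1)])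
    moreover have "continuously_extendable (indicator ?A) y z"
      using y z by (intro ext) auto
    ultimately show False by contradiction
  qed
  then show ?thesis
    using tauQ_continuous_cut[OF h(1) \<theta>(3)] unfolding Q_continuous_at_def by blast
qed

end
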